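(* Let $d\in\mathbb{N}$ and let $\mathcal{F}$ be a family of compact connected subsets of $\mathbb{R}^d$ that has no finite hyperplane transversal. Suppose there exist a point $p\in\mathbb{R}^d$ and a ray $\vec{r}=\{p+tv\mid t\ge0\}$, $v\in\mathbb{S}^{d-1}$, such that for every $n\in\mathbb{N}$ the family $\{B\in\mathcal{F}\mid B\subset Q(\vec{r},n)\}$ has no finite hyperplane transversal. Then there is a sequence $\{B_n\}_{n\in\mathbb{N}}\subseteq\mathcal{F}$ such that for any distinct indices $i_1,\dots,i_{d+1}\in\mathbb{N}$ there is no hyperplane intersecting every one of $B_{i_1},\dots,B_{i_{d+1}}$.
   Context: A hyperplane in $\mathbb{R}^d$ is an affine subspace of dimension $d-1$ (a point when $d=1$). A finite hyperplane transversal of a family $\mathcal{G}$ of sets is a finite set of hyperplanes such that every set in $\mathcal{G}$ intersects at least one of them. $B(p,\epsilon)$ denotes the open ball of radius $\epsilon$ centered at $p$. For a ray $\vec{r}=\{p+tv\mid t\ge0\}$ and $n\in\mathbb{N}$, let $U_n=\{u\in\mathbb{R}^d\mid \langle u,v\rangle=1,\ \|u-v\|\le\tfrac1n\}$, $C_n=\{p+tu\mid t\ge0,\ u\in U_n\}$ (the closed circular cone with apex $p$ through the disc of radius $1/n$ centered at $p+v$ perpendicular to $v$), and $Q(\vec{r},n):=C_n\setminus B(p,n)$. *)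

theory Defs
  imports "HOL-Analysis.Analysis"
begin

definition is_hyperplane :: "(real ^ 'd) set \<Rightarrow> bool" where
  "is_hyperplane H \<longleftrightarrow> affine H \<and> aff_dim H = int CARD('d) - 1"

definition has_finite_hyperplane_transversal :: "(real ^ 'd) set set \<Rightarrow> bool" where
  "has_finite_hyperplane_transversal \<G> \<longleftrightarrow>
     (\<exists>\<H>. finite \<H> \<and> (\<forall>H\<in>\<H>. is_hyperplane H) \<and> (\<forall>G\<in>\<G>. \<exists>H\<in>\<H>. G \<inter> H \<noteq> {}))"

text \<open>A ray is represented by its apex \<open>p\<close> and its unit direction \<open>v\<close>, both of which it determines.
  The parameter \<open>n\<close> below is meant to be positive.\<close>

definition cone_disc :: "real ^ 'd \<Rightarrow> nat \<Rightarrow> (real ^ 'd) set" where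
  "cone_disc v n = {u. u \<bullet> v = 1 \<and> norm (u - v) \<le> 1 / real n}"

definition ray_cone :: "real ^ 'd \<Rightarrow> real ^ 'd \<Rightarrow> nat \<Rightarrow> (real ^ 'd) set" where
  "ray_cone p v n = {p + t *\<^sub>R u | t u. t \<ge> 0 \<and> u \<in> cone_disc v n}"

definition ray_region :: "real ^ 'd \<Rightarrow> real ^ 'd \<Rightarrow> nat \<Rightarrow> (real ^ 'd) set" where
  "ray_region p v n = ray_cone p v n - ball p (real n)"

end

theory Submission
  imports Defs
begin

text \<open>Embed the affine space as the hyperplane at height 1 of a vector space of one dimension more and
  project radially to the unit sphere, so that hyperplanes become linear.  By compactness of the sphere
  and connectedness of the sets, the members of the family that lie in an arbitrarily small
  neighbourhood of some point \<open>w\<close> still have no finite transversal.  Projecting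
  from \<open>w\<close> reduces the dimension by one: by induction one finds sets shrinking to \<open>w\<close> such that no
  \<open>m\<close> of them meet a common hyperplane through \<open>w\<close>.  By compactness the hyperplanes that meet \<open>m\<close>
  given sets of this sequence stay away from \<open>w\<close>, so they miss all later sets, and a sufficiently
  sparse subsequence works.\<close>

section \<open>Piercing by finitely many linear hyperplanes\<close>

text \<open>A linear hyperplane is represented by a normal vector \<open>\<phi>\<close>; that
  \<open>\<phi>\<close> is nonzero is required at each use.\<close>

definition pierces :: "'a::euclidean_space \<Rightarrow> 'a set \<Rightarrow> bool" where
  "pierces \<phi> B \<longleftrightarrow> (\<exists>x\<in>B. \<phi> \<bullet> x = 0)"

text \<open>Nonzero normals taken from \<open>S\<close> cut \<open>S\<close> in proper linear
  hyperplanes of \<open>S\<close>. The family is indexed so that the sets can be replaced by their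
  projections while the index sets stay in place.\<close>

definition finitely_pierced :: "'a::euclidean_space set \<Rightarrow> ('i \<Rightarrow> 'a set) \<Rightarrow> 'i set \<Rightarrow> bool" where
  "finitely_pierced S X A \<longleftrightarrow>
     (\<exists>\<Phi>. finite \<Phi> \<and> \<Phi> \<subseteq> S - {0} \<and> (\<forall>i\<in>A. \<exists>\<phi>\<in>\<Phi>. pierces \<phi> (X i)))"

lemma finitely_pierced_empty: "finitely_pierced S X {}"
  unfolding finitely_pierced_def by (rule exI[of _ "{}"]) simp

lemma finitely_pierced_subset:
  "finitely_pierced S X A \<Longrightarrow> B \<subseteq> A \<Longrightarrow> finitely_pierced S X B"
  unfolding finitely_pierced_def by (elim exE, rule exI) (auto dest: subsetD)

lemma finitely_pierced_Un:
  assumes "finitely_pierced S X A" "finitely_pierced S X B"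
  shows "finitely_pierced S X (A \<union> B)"
proof -
  obtain \<Phi> where \<Phi>: "finite \<Phi>" "\<Phi> \<subseteq> S - {0}" "\<forall>i\<in>A. \<exists>\<phi>\<in>\<Phi>. pierces \<phi> (X i)"
    using assms(1) unfolding finitely_pierced_def by blast
  obtain \<Psi> where \<Psi>: "finite \<Psi>" "\<Psi> \<subseteq> S - {0}" "\<forall>i\<in>B. \<exists>\<phi>\<in>\<Psi>. pierces \<phi> (X i)"
    using assms(2) unfolding finitely_pierced_def by blast
  have "finite (\<Phi> \<union> \<Psi>)" "\<Phi> \<union> \<Psi> \<subseteq> S - {0}"
    using \<Phi>(1,2) \<Psi>(1,2) by auto
  moreover have "\<forall>i\<in>A \<union> B. \<exists>\<phi>\<in>\<Phi> \<union> \<Psi>. pierces \<phi> (X i)"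
    using \<Phi>(3) \<Psi>(3) by blast
  ultimately show ?thesis
    unfolding finitely_pierced_def by (intro exI conjI)
qed

lemma finitely_pierced_UN:
  assumes "finite D" "\<And>q. q \<in> D \<Longrightarrow> finitely_pierced S X (A q)"
  shows "finitely_pierced S X (\<Union>q\<in>D. A q)"
  using assms
proof (induction D)
  case empty
  then show ?case by (simp add: finitely_pierced_empty)
next
  case (insert q D)
  then show ?case by (simp add: finitely_pierced_Un)
qed

section \<open>Localisation at a point of the unit sphere\<close>

text \<open>Two distinct unit vectors are strictly separated by their difference. Strict separation
  is an open condition and the pairs at distance at least \<open>\<delta>\<close> form a compact
  set, so finitely many functionals suffice.\<close>

lemma finite_separating_functionals:
  fixes S :: "'a::euclidean_space set"
  assumes "subspace S" "\<delta> > 0"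
  obtains \<Phi> where "finite \<Phi>" "\<Phi> \<subseteq> S - {0}"
    "\<And>x y. x \<in> S \<inter> sphere 0 1 \<Longrightarrow> y \<in> S \<inter> sphere 0 1 \<Longrightarrow> dist x y \<ge> \<delta> \<Longrightarrow>
       \<exists>\<phi>\<in>\<Phi>. \<phi> \<bullet> x < 0 \<and> 0 < \<phi> \<bullet> y"
proof -
  define K where "K = S \<inter> sphere (0::'a) 1"
  define T where "T = (K \<times> K) \<inter> {z. dist (fst z) (snd z) \<ge> \<delta>}"
  have "compact K"
    unfolding K_def using assms(1) by (simp add: closed_subspace closed_Int_compact)
  moreover have "closed {z::'a \<times> 'a. dist (fst z) (snd z) \<ge> \<delta>}"
    by (intro closed_Collect_le continuous_intros)
  ultimately have "compact T"
    unfolding T_def by (intro compact_Int_closed compact_Times)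
  have op: "open {z. \<phi> \<bullet> fst z < 0 \<and> 0 < \<phi> \<bullet> snd z}" for \<phi> :: 'a
    by (intro open_Collect_conj open_Collect_less continuous_intros)
  have sub: "T \<subseteq> (\<Union>\<phi>\<in>S - {0}. {z. \<phi> \<bullet> fst z < 0 \<and> 0 < \<phi> \<bullet> snd z})"
  proof
    fix z assume "z \<in> T"
    define x y where "x = fst z" and "y = snd z"
    have xy: "x \<in> S" "y \<in> S" "x \<bullet> x = 1" "y \<bullet> y = 1" "x \<noteq> y"
      using \<open>z \<in> T\<close> assms(2) by (auto simp: T_def K_def x_def y_def norm_eq_1)
    \<comment> \<open>For unit vectors this says that \<open>x \<bullet> y < 1\<close>, which gives
      both signs below.\<close>
    have "0 < (y - x) \<bullet> (y - x)"
      using xy(5) by (subst inner_gt_zero_iff) auto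
    then have "(y - x) \<bullet> x < 0" "0 < (y - x) \<bullet> y"
      using xy by (auto simp: inner_diff_left inner_diff_right inner_commute)
    then show "z \<in> (\<Union>\<phi>\<in>S - {0}. {z. \<phi> \<bullet> fst z < 0 \<and> 0 < \<phi> \<bullet> snd z})"
      using xy assms(1) by (auto simp: x_def y_def subspace_diff intro!: bexI[of _ "y - x"])
  qed
  obtain \<Phi> where \<Phi>: "\<Phi> \<subseteq> S - {0}" "finite \<Phi>"
      "T \<subseteq> (\<Union>\<phi>\<in>\<Phi>. {z. \<phi> \<bullet> fst z < 0 \<and> 0 < \<phi> \<bullet> snd z})"
    by (rule compactE_image[OF \<open>compact T\<close> op sub])
  show thesis
  proof (rule that[of \<Phi>])
    fix x y assume "x \<in> S \<inter> sphere 0 1" "y \<in> S \<inter> sphere 0 1" "dist x y \<ge> \<delta>"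
    then have "(x, y) \<in> T"
      by (auto simp: T_def K_def)
    then show "\<exists>\<phi>\<in>\<Phi>. \<phi> \<bullet> x < 0 \<and> 0 < \<phi> \<bullet> y"
      using \<Phi>(3) by fastforce
  qed (use \<Phi> in auto)
qed

text \<open>Otherwise finitely many balls, each with a finitely pierced family of members inside,
  cover the sphere. Members smaller than a Lebesgue number of the cover lie in one of these balls,
  and the larger ones, being connected, are cut by one of finitely many separating functionals.
  Together these would pierce some \<open>F M\<close>.\<close>

lemma not_finitely_pierced_localises:
  fixes S :: "'a::euclidean_space set" and X :: "'i \<Rightarrow> 'a set"
  assumes S: "subspace S" "dim S > 0" and F: "decseq F"
    and X: "\<And>i. i \<in> F 0 \<Longrightarrow> connected (X i) \<and> X i \<subseteq> S \<inter> sphere 0 1"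
    and notp: "\<And>n. \<not> finitely_pierced S X (F n)"
  obtains w where "w \<in> S \<inter> sphere 0 1"
    "\<And>n. \<not> finitely_pierced S X {i \<in> F n. X i \<subseteq> ball w (1 / real (Suc n))}"
proof (rule ccontr)
  assume "\<not> thesis"
  with that have "\<forall>q\<in>S \<inter> sphere 0 1.
      \<exists>n. finitely_pierced S X {i \<in> F n. X i \<subseteq> ball q (1 / real (Suc n))}"
    by blast
  then obtain N where N: "\<And>q. q \<in> S \<inter> sphere 0 1 \<Longrightarrow>
      finitely_pierced S X {i \<in> F (N q). X i \<subseteq> ball q (1 / real (Suc (N q)))}"
    by metis
  define K where "K = S \<inter> sphere (0::'a) 1"
  define U where "U q = ball q (1 / real (Suc (N q)))" for q :: 'a
  have "compact K"
    unfolding K_def using S by (simp add: closed_subspace closed_Int_compact)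
  have "K \<noteq> {}"
  proof -
    have "\<not> S \<subseteq> {0}"
      using S(2) by (metis dim_eq_0 less_irrefl)
    then obtain x where "x \<in> S" "x \<noteq> 0" by blast
    then have "x /\<^sub>R norm x \<in> K"
      using S by (auto simp: K_def subspace_scale)
    then show ?thesis by blast
  qed
  have "K \<subseteq> (\<Union>q\<in>K. U q)"
    by (auto simp: U_def)
  then obtain D where D: "D \<subseteq> K" "finite D" "K \<subseteq> (\<Union>q\<in>D. U q)"
    by (rule compactE_image[OF \<open>compact K\<close>, rotated]) (auto simp: U_def)
  then have "D \<noteq> {}"
    using \<open>K \<noteq> {}\<close> by auto
  \<comment> \<open>\<open>\<delta>\<close> is a Lebesgue number of the finite cover.\<close>
  obtain \<delta> where \<delta>: "\<delta> > 0" "\<And>x. x \<in> K \<Longrightarrow> \<exists>G\<in>U ` D. ball x \<delta> \<subseteq> G"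
    by (rule Heine_Borel_lemma[OF \<open>compact K\<close> D(3)]) (auto simp: U_def)
  obtain \<Phi> where \<Phi>: "finite \<Phi>" "\<Phi> \<subseteq> S - {0}"
    "\<And>x y. x \<in> K \<Longrightarrow> y \<in> K \<Longrightarrow> dist x y \<ge> \<delta> \<Longrightarrow> \<exists>\<phi>\<in>\<Phi>. \<phi> \<bullet> x < 0 \<and> 0 < \<phi> \<bullet> y"
    unfolding K_def by (rule finite_separating_functionals[OF S(1) \<delta>(1)]) blast
  \<comment> \<open>As \<open>F\<close> decreases, \<open>F M\<close> is contained in every
    \<open>F (N q)\<close> with \<open>q \<in> D\<close>.\<close>
  define M where "M = Max (N ` D)"
  define L where "L = {i \<in> F 0. \<exists>x\<in>X i. \<exists>y\<in>X i. dist x y \<ge> \<delta>}"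
  have "finitely_pierced S X L"
    unfolding finitely_pierced_def
  proof (intro exI[of _ \<Phi>] conjI ballI)
    fix i assume "i \<in> L"
    then obtain x y where xy: "i \<in> F 0" "x \<in> X i" "y \<in> X i" "dist x y \<ge> \<delta>"
      by (auto simp: L_def)
    then have "x \<in> K" "y \<in> K"
      using X[of i] by (auto simp: K_def)
    then obtain \<phi> where "\<phi> \<in> \<Phi>" "\<phi> \<bullet> x < 0" "0 < \<phi> \<bullet> y"
      using \<Phi>(3) xy(4) by blast
    then show "\<exists>\<phi>\<in>\<Phi>. pierces \<phi> (X i)"
      unfolding pierces_def
      using connected_ivt_hyperplane[of "X i" x y \<phi> 0] X xy by force
  qed (use \<Phi> in auto)
  moreover have "finitely_pierced S X (\<Union>q\<in>D. {i \<in> F (N q). X i \<subseteq> U q})"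
  proof (rule finitely_pierced_UN[OF D(2)])
    fix q assume "q \<in> D"
    then have "q \<in> S \<inter> sphere 0 1"
      using D(1) K_def by blast
    from N[OF this] show "finitely_pierced S X {i \<in> F (N q). X i \<subseteq> U q}"
      by (simp only: U_def)
  qed
  moreover have "F M \<subseteq> L \<union> (\<Union>q\<in>D. {i \<in> F (N q). X i \<subseteq> U q})"
  proof
    fix i assume i: "i \<in> F M"
    have FN: "i \<in> F (N q)" if "q \<in> D" for q
      using decseqD[OF F, of "N q" M] that D(2) i by (auto simp: M_def)
    have i0: "i \<in> F 0"
      using decseqD[OF F, of 0 M] i by auto
    show "i \<in> L \<union> (\<Union>q\<in>D. {i \<in> F (N q). X i \<subseteq> U q})"
    proof (cases "i \<in> L")
      case False
      have "\<exists>q\<in>D. X i \<subseteq> U q"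
      \<comment> \<open>An empty member lies in any ball, so it is enough that \<open>D\<close> is
        nonempty.\<close>
      proof (cases "X i = {}")
        case True
        then show ?thesis using \<open>D \<noteq> {}\<close> by auto
      next
        case nonempty: False
        then obtain x where x: "x \<in> X i" by blast
        have "X i \<subseteq> ball x \<delta>"
          using False x i0 by (force simp: L_def)
        moreover have "x \<in> K"
          using x X[OF i0] by (auto simp: K_def)
        ultimately show ?thesis
          using \<delta>(2)[of x] by blast
      qed
      then show ?thesis using FN by blast
    qed simp
  qed
  ultimately show False
    using finitely_pierced_subset[OF finitely_pierced_Un] notp by blast
qed

section \<open>Hyperplanes that stay away from a point\<close>

text \<open>The set is the projection of a closed incidence relation along the compact factor
  \<open>B\<close>.\<close>

lemma closed_pierces:
  fixes B :: "'a::euclidean_space set"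
  assumes "compact B"
  shows "closed {\<phi>. pierces \<phi> B}"
proof -
  have "closed {z::'a \<times> 'a. snd z \<bullet> fst z = 0}"
    by (intro closed_Collect_eq continuous_intros)
  from closed_compact_projection[OF assms this]
  show ?thesis by (simp add: pierces_def Bex_def)
qed

lemma dim_orthogonal_in_subspace:
  fixes S :: "'a::euclidean_space set"
  assumes "subspace S" "w \<in> S" "w \<noteq> 0"
  shows "dim {x \<in> S. w \<bullet> x = 0} + 1 = dim S"
proof -
  have "(\<forall>x\<in>span {w}. orthogonal x y) \<longleftrightarrow> w \<bullet> y = 0" for y
    by (auto simp: span_singleton orthogonal_def dest: spec[of _ 1])
  moreover have "dim (span {w}) = 1"
    using assms(3) by simp
  moreover have "span {w} \<subseteq> S"
    using assms by (simp add: span_minimal)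
  ultimately show ?thesis
    using dim_subspace_orthogonal_to_vectors[of "span {w}" S] assms(1) by simp
qed

text \<open>The unit normals piercing all \<open>Y i\<close> form a compact set on which
  \<open>w \<bullet> \<phi>\<close> never vanishes, so its absolute value is bounded below by some
  \<open>\<delta> > 0\<close>. This value is the distance from \<open>w\<close> to the hyperplane,
  so smaller balls are missed.\<close>

lemma eventually_unpierced_near_point:
  fixes S :: "'a::euclidean_space set"
  assumes S: "subspace S" and "finite I"
    and Y: "\<And>i. i \<in> I \<Longrightarrow> compact (Y i)"
    and miss: "\<And>\<phi>. \<phi> \<in> S - {0} \<Longrightarrow> w \<bullet> \<phi> = 0 \<Longrightarrow> \<exists>i\<in>I. \<not> pierces \<phi> (Y i)"
  shows "\<forall>\<^sub>F k in sequentially. \<forall>\<phi>\<in>S - {0}.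
      (\<forall>i\<in>I. pierces \<phi> (Y i)) \<longrightarrow> \<not> pierces \<phi> (ball w (1 / real (Suc k)))"
proof -
  define Z where "Z = (S \<inter> sphere 0 1) \<inter> (\<Inter>i\<in>I. {\<phi>. pierces \<phi> (Y i)})"
  have "closed (\<Inter>i\<in>I. {\<phi>. pierces \<phi> (Y i)})"
    using Y closed_pierces by blast
  moreover have "compact (S \<inter> sphere 0 1)"
    using S by (simp add: closed_subspace closed_Int_compact)
  ultimately have "compact Z"
    unfolding Z_def using compact_Int_closed by blast
  obtain \<delta> where \<delta>: "\<delta> > 0" "\<And>\<phi>. \<phi> \<in> Z \<Longrightarrow> \<delta> \<le> \<bar>w \<bullet> \<phi>\<bar>"
  proof (cases "Z = {}")
    case True
    then show ?thesis using that[of 1] by auto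
  next
    case False
    have "continuous_on Z (\<lambda>\<phi>. \<bar>w \<bullet> \<phi>\<bar>)"
      by (intro continuous_intros)
    then obtain \<psi> where \<psi>: "\<psi> \<in> Z" "\<And>\<phi>. \<phi> \<in> Z \<Longrightarrow> \<bar>w \<bullet> \<psi>\<bar> \<le> \<bar>w \<bullet> \<phi>\<bar>"
      using continuous_attains_inf[OF \<open>compact Z\<close> False] by blast
    moreover have "w \<bullet> \<psi> \<noteq> 0"
      using miss[of \<psi>] \<psi>(1) by (force simp: Z_def)
    ultimately show ?thesis using that[of "\<bar>w \<bullet> \<psi>\<bar>"] by auto
  qed
  have "\<forall>\<^sub>F k in sequentially. 1 / real (Suc k) < \<delta>"
    using order_tendstoD(2)[OF LIMSEQ_inverse_real_of_nat \<delta>(1)]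
    by (simp add: inverse_eq_divide)
  then show ?thesis
  proof eventually_elim
    case (elim k)
    show ?case
    proof (intro ballI impI notI)
      fix \<phi> assume \<phi>: "\<phi> \<in> S - {0}" "\<forall>i\<in>I. pierces \<phi> (Y i)"
        and "pierces \<phi> (ball w (1 / real (Suc k)))"
      then obtain x where x: "dist w x < 1 / real (Suc k)" "\<phi> \<bullet> x = 0"
        by (auto simp: pierces_def)
      define \<psi> where "\<psi> = \<phi> /\<^sub>R norm \<phi>"
      have "\<psi> \<in> Z"
        using \<phi> S by (auto simp: Z_def \<psi>_def subspace_scale pierces_def)
      have "w \<bullet> \<psi> = (w - x) \<bullet> \<psi>"
        using x(2) by (simp add: \<psi>_def inner_diff_right inner_commute[of _ \<phi>])
      also have "\<bar>\<dots>\<bar> \<le> norm (w - x) * norm \<psi>"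
        by (rule Cauchy_Schwarz_ineq2)
      also have "norm \<psi> = 1"
        using \<phi>(1) by (simp add: \<psi>_def)
      finally show False
        using \<delta>(2)[OF \<open>\<psi> \<in> Z\<close>] x(1) elim by (simp add: dist_norm)
    qed
  qed
qed

section \<open>Induction on the dimension\<close>

lemma sparse_subsequence:
  assumes "\<And>n::nat. \<forall>\<^sub>F k in sequentially. P n k"
  obtains s :: "nat \<Rightarrow> nat" where "strict_mono s" "\<And>j. P (s j) (s (Suc j))"
proof -
  \<comment> \<open>The conjunct \<open>True\<close> fills the slot for a condition on single terms
    in \<open>dependent_nat_choice\<close>.\<close>
  have "\<exists>s. \<forall>j. True \<and> s j < s (Suc j) \<and> P (s j) (s (Suc j))"
  proof (rule dependent_nat_choice)
    fix n m :: nat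
    have "\<forall>\<^sub>F k in sequentially. n < k \<and> P n k"
      using assms eventually_gt_at_top by (intro eventually_conj) auto
    then show "\<exists>k. True \<and> n < k \<and> P n k"
      by (auto dest: eventually_happens)
  qed simp
  then show thesis
    using that by (metis strict_mono_Suc_iff)
qed

text \<open>The decreasing chain \<open>F\<close> strengthens the induction: when the chain consists
  of members ever closer to \<open>w\<close>, the condition \<open>b n \<in> F n\<close> makes the
  chosen sets shrink to \<open>w\<close>.\<close>

lemma linear_hyperplane_sequence:
  fixes S :: "'a::euclidean_space set" and X :: "'i \<Rightarrow> 'a set"
  assumes "subspace S" "dim S = Suc m" "decseq F"
    and "\<And>i. i \<in> F 0 \<Longrightarrow> compact (X i) \<and> connected (X i) \<and> X i \<subseteq> S \<inter> sphere 0 1"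
    and "\<And>n. \<not> finitely_pierced S X (F n)"
  shows "\<exists>b :: nat \<Rightarrow> 'i. (\<forall>n. b n \<in> F n) \<and>
    (\<forall>\<phi>\<in>S - {0}. \<forall>I. card I = Suc m \<longrightarrow> (\<exists>n\<in>I. \<not> pierces \<phi> (X (b n))))"
  using assms
proof (induction m arbitrary: S X F)
  case 0
  have "\<exists>i. i \<in> F n" for n
    using 0(5)[of n] finitely_pierced_empty by (metis ex_in_conv)
  then obtain b where b: "\<And>n. b n \<in> F n"
    by metis
  have "\<not> pierces \<phi> (X (b n))" if \<phi>: "\<phi> \<in> S - {0}" for \<phi> n
  proof
    assume "pierces \<phi> (X (b n))"
    then obtain x where x: "x \<in> X (b n)" "\<phi> \<bullet> x = 0"
      by (auto simp: pierces_def)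
    have "b n \<in> F 0"
      using decseqD[OF 0(3), of 0 n] b[of n] by auto
    then have xS: "x \<in> S" "x \<noteq> 0"
      using 0(4)[of "b n"] x(1) by force+
    \<comment> \<open>In a line, a hyperplane is the origin alone, and this is not on the
      sphere.\<close>
    have "dim {x \<in> S. \<phi> \<bullet> x = 0} = 0"
      using dim_orthogonal_in_subspace[OF 0(1), of \<phi>] \<phi> 0(2) by auto
    then have "{x \<in> S. \<phi> \<bullet> x = 0} \<subseteq> {0}"
      by (simp only: dim_eq_0)
    then show False using x(2) xS by auto
  qed
  then show ?case
    using b by (intro exI[of _ b]) (metis One_nat_def card_1_singletonE insertI1)
next
  case (Suc m)
  have X: "compact (X i)" "connected (X i)" "X i \<subseteq> S \<inter> sphere 0 1" if "i \<in> F n" for i n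
    using Suc.prems(4)[of i] decseqD[OF Suc.prems(3), of 0 n] that by auto
  obtain w where w: "w \<in> S \<inter> sphere 0 1"
    "\<And>n. \<not> finitely_pierced S X {i \<in> F n. X i \<subseteq> ball w (1 / real (Suc n))}"
    using not_finitely_pierced_localises[OF Suc.prems(1) _ Suc.prems(3) _ Suc.prems(5)]
      Suc.prems(2,4) by (metis zero_less_Suc)
  define W where "W = {x \<in> S. w \<bullet> x = 0}"
  have ww: "w \<bullet> w = 1" "w \<noteq> 0"
    using w(1) by (auto simp: norm_eq_1)
  have W: "subspace W" "dim W = Suc m"
    using Suc.prems(1,2) dim_orthogonal_in_subspace[of S w] w(1) ww
    by (auto simp: W_def subspace_def inner_add_right)
  then have "\<not> W \<subseteq> {0}"
    by (metis dim_eq_0 nat.distinct(1))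
  then obtain h where h: "h \<in> W" "h \<noteq> 0"
    by blast
  \<comment> \<open>Discarding the members pierced by \<open>h\<close> costs a single hyperplane.
    Since \<open>h\<close> is orthogonal to \<open>w\<close>, the remaining members miss the line
    through \<open>w\<close>, where \<open>\<pi>\<close> vanishes, so that \<open>g\<close> is
    continuous on them.\<close>
  define G where
    "G n = {i \<in> F n. X i \<subseteq> ball w (1 / real (Suc n)) \<and> \<not> pierces h (X i)}" for n
  define \<pi> where "\<pi> x = x - (w \<bullet> x) *\<^sub>R w" for x
  define g where "g x = \<pi> x /\<^sub>R norm (\<pi> x)" for x
  have \<pi>_inner: "\<phi> \<bullet> \<pi> x = \<phi> \<bullet> x" if "\<phi> \<in> W" for \<phi> x
    using that by (simp add: W_def \<pi>_def inner_diff_right inner_commute)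
  have \<pi>_W: "\<pi> x \<in> W" if "x \<in> S" for x
    using that w(1) Suc.prems(1) ww
    by (simp add: W_def \<pi>_def inner_diff_right subspace_diff subspace_scale)
  have \<pi>_nz: "\<pi> x \<noteq> 0" if "i \<in> G n" "x \<in> X i" for i n x
    using that \<pi>_inner[OF h(1), of x] by (auto simp: G_def pierces_def)
  \<comment> \<open>Hyperplanes through \<open>w\<close> have their normals in \<open>W\<close>; for
    these, projecting from \<open>w\<close> does not affect incidence.\<close>
  have pierces_g: "pierces \<phi> (g ` X i) \<longleftrightarrow> pierces \<phi> (X i)" if "\<phi> \<in> W" "i \<in> G n" for \<phi> i n
    using \<pi>_inner[OF that(1)] \<pi>_nz[OF that(2)] by (auto simp: pierces_def g_def)
  have "\<exists>b. (\<forall>n. b n \<in> G n) \<and>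
    (\<forall>\<phi>\<in>W - {0}. \<forall>I. card I = Suc m \<longrightarrow> (\<exists>n\<in>I. \<not> pierces \<phi> (g ` X (b n))))"
  proof (rule Suc.IH[OF W])
    show "decseq G"
    proof (rule decseq_SucI)
      fix n
      have "ball w (1 / real (Suc (Suc n))) \<subseteq> ball w (1 / real (Suc n))"
        by (intro subset_ball) (simp add: frac_le)
      then show "G (Suc n) \<le> G n"
        using decseqD[OF Suc.prems(3), of n "Suc n"] by (auto simp: G_def)
    qed
  next
    fix i assume i: "i \<in> G 0"
    then have "i \<in> F 0" by (simp add: G_def)
    note Xi = X[OF this]
    have "continuous_on (X i) g"
      unfolding g_def \<pi>_def using \<pi>_nz[OF i]
      by (intro continuous_intros) (auto simp: \<pi>_def)
    then show "compact (g ` X i) \<and> connected (g ` X i) \<and> g ` X i \<subseteq> W \<inter> sphere 0 1"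
      using Xi \<pi>_nz[OF i] \<pi>_W W(1)
      by (auto simp: g_def compact_continuous_image connected_continuous_image subspace_scale)
  next
    fix n
    show "\<not> finitely_pierced W (\<lambda>i. g ` X i) (G n)"
    proof
      assume "finitely_pierced W (\<lambda>i. g ` X i) (G n)"
      then obtain \<Phi> where \<Phi>: "finite \<Phi>" "\<Phi> \<subseteq> W - {0}"
          "\<forall>i\<in>G n. \<exists>\<phi>\<in>\<Phi>. pierces \<phi> (g ` X i)"
        unfolding finitely_pierced_def by blast
      have "finitely_pierced S X {i \<in> F n. X i \<subseteq> ball w (1 / real (Suc n))}"
        unfolding finitely_pierced_def
      \<comment> \<open>Adding \<open>h\<close> takes care of the members discarded in
        \<open>G n\<close>, contrary to the choice of \<open>w\<close>.\<close>
      proof (intro exI[of _ "insert h \<Phi>"] conjI ballI)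
        show "insert h \<Phi> \<subseteq> S - {0}"
          using \<Phi>(2) h by (auto simp: W_def)
        fix i assume i: "i \<in> {i \<in> F n. X i \<subseteq> ball w (1 / real (Suc n))}"
        show "\<exists>\<phi>\<in>insert h \<Phi>. pierces \<phi> (X i)"
        proof (cases "pierces h (X i)")
          case False
          then have "i \<in> G n" using i by (simp add: G_def)
          then show ?thesis using \<Phi>(2,3) pierces_g by blast
        qed simp
      qed (use \<Phi> in simp)
      then show False using w(2) by blast
    qed
  qed
  then obtain b where b: "\<And>n. b n \<in> G n"
    "\<And>\<phi> I. \<phi> \<in> W - {0} \<Longrightarrow> card I = Suc m \<Longrightarrow> \<exists>n\<in>I. \<not> pierces \<phi> (X (b n))"
    using pierces_g by (metis DiffD1)
  have bF: "b n \<in> F n" and bball: "X (b n) \<subseteq> ball w (1 / real (Suc n))" for n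
    using b(1)[of n] by (auto simp: G_def)
  \<comment> \<open>A hyperplane meeting \<open>Suc m\<close> of the sets up to index
    \<open>n\<close> misses the ball about \<open>w\<close> that contains the set of index
    \<open>k\<close>.\<close>
  define P where "P n k \<longleftrightarrow> (\<forall>I\<in>{I. I \<subseteq> {..n} \<and> card I = Suc m}. \<forall>\<phi>\<in>S - {0}.
      (\<forall>i\<in>I. pierces \<phi> (X (b i))) \<longrightarrow> \<not> pierces \<phi> (ball w (1 / real (Suc k))))" for n k
  have "\<forall>\<^sub>F k in sequentially. P n k" for n
    unfolding P_def
  proof (rule eventually_ball_finite)
    show "finite {I. I \<subseteq> {..n} \<and> card I = Suc m}"
      by (rule finite_subset[of _ "Pow {..n}"]) auto
    show "\<forall>I\<in>{I. I \<subseteq> {..n} \<and> card I = Suc m}. \<forall>\<^sub>F k in sequentially. \<forall>\<phi>\<in>S - {0}.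
      (\<forall>i\<in>I. pierces \<phi> (X (b i))) \<longrightarrow> \<not> pierces \<phi> (ball w (1 / real (Suc k)))"
    proof
      fix I assume I: "I \<in> {I. I \<subseteq> {..n} \<and> card I = Suc m}"
      show "\<forall>\<^sub>F k in sequentially. \<forall>\<phi>\<in>S - {0}.
        (\<forall>i\<in>I. pierces \<phi> (X (b i))) \<longrightarrow> \<not> pierces \<phi> (ball w (1 / real (Suc k)))"
      proof (rule eventually_unpierced_near_point[OF Suc.prems(1)])
        show "finite I" using I finite_subset by auto
        show "compact (X (b i))" for i using X(1) bF by blast
        \<comment> \<open>Such a \<open>\<phi>\<close> lies in \<open>W\<close>, where the sequence
          from the induction hypothesis applies.\<close>
        show "\<exists>i\<in>I. \<not> pierces \<phi> (X (b i))" if "\<phi> \<in> S - {0}" "w \<bullet> \<phi> = 0" for \<phi>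
          using b(2)[of \<phi> I] that I by (auto simp: W_def)
      qed
    qed
  qed
  then obtain s where s: "strict_mono s" "\<And>j. P (s j) (s (Suc j))"
    using sparse_subsequence[of P] by metis
  show ?case
  proof (intro exI[of _ "b \<circ> s"] conjI allI ballI impI)
    fix n
    show "(b \<circ> s) n \<in> F n"
      using bF[of "s n"] decseqD[OF Suc.prems(3), of n "s n"] strict_mono_imp_increasing[OF s(1)]
      by auto
  next
    fix \<phi> and I :: "nat set" assume \<phi>: "\<phi> \<in> S - {0}" and I: "card I = Suc (Suc m)"
    have fin: "finite I" "I \<noteq> {}"
      using I card.infinite by fastforce+
    \<comment> \<open>The remaining \<open>Suc m\<close> indices are below \<open>M\<close>. A
      hyperplane meeting their sets must miss the set at \<open>M\<close>, by \<open>P\<close>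
      between the consecutive terms \<open>s l\<close> and \<open>s M\<close>.\<close>
    define M where "M = Max I"
    have M: "M \<in> I" "\<And>i. i \<in> I \<Longrightarrow> i \<le> M"
      using fin by (auto simp: M_def)
    have card': "card (I - {M}) = Suc m"
      using I M fin by simp
    \<comment> \<open>Any further index is smaller than \<open>M\<close>, so \<open>M\<close> is a
      successor.\<close>
    then obtain i where "i \<in> I - {M}"
      by (metis card.empty ex_in_conv nat.distinct(1))
    then obtain l where l: "M = Suc l"
      using M(2)[of i] by (cases M) auto
    have "i \<le> l" if "i \<in> I - {M}" for i
      using M(2)[of i] that l by auto
    then have "s ` (I - {M}) \<subseteq> {..s l}"
      using strict_mono_less_eq[OF s(1)] by auto
    moreover have "card (s ` (I - {M})) = Suc m"
      using card' s(1) by (simp add: card_image strict_mono_imp_inj_on)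
    ultimately have "(\<forall>i\<in>s ` (I - {M}). pierces \<phi> (X (b i))) \<longrightarrow>
        \<not> pierces \<phi> (ball w (1 / real (Suc (s M))))"
      using s(2)[of l] \<phi> unfolding P_def l by blast
    then show "\<exists>n\<in>I. \<not> pierces \<phi> (X ((b \<circ> s) n))"
      using M(1) bball[of "s M"] by (fastforce simp: pierces_def)
  qed
qed

section \<open>From affine to linear hyperplanes\<close>

lemma is_hyperplane_iff:
  fixes H :: "(real ^ 'd) set"
  shows "is_hyperplane H \<longleftrightarrow> (\<exists>a b. a \<noteq> 0 \<and> H = {x. a \<bullet> x = b})"
proof -
  have "is_hyperplane H \<longleftrightarrow> affine H \<and> (\<exists>a b. a \<noteq> 0 \<and> affine hull H = {x. a \<bullet> x = b})"
    using aff_dim_eq_hyperplane[of H] by (simp add: is_hyperplane_def)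
  then show ?thesis
    by (metis affine_hull_eq affine_hyperplane)
qed

text \<open>This is the central (gnomonic) projection to the open upper hemisphere.\<close>

definition homogenise :: "'a::real_normed_vector \<Rightarrow> 'a \<times> real" where
  "homogenise x = (x, 1) /\<^sub>R norm (x, 1::real)"

lemma norm_homogenise: "norm (homogenise x) = 1"
  by (simp add: homogenise_def zero_prod_def del: scaleR_Pair)

text \<open>Dividing by a positive norm does not change where \<open>\<phi>\<close> vanishes, so
  only the slice at height 1 matters.\<close>

lemma pierces_homogenise:
  "pierces \<phi> (homogenise ` B) \<longleftrightarrow> (\<exists>x\<in>B. fst \<phi> \<bullet> x = - snd \<phi>)"
proof -
  have "\<phi> \<bullet> homogenise x = 0 \<longleftrightarrow> fst \<phi> \<bullet> x = - snd \<phi>" for x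
  proof -
    have "\<phi> \<bullet> homogenise x = (fst \<phi> \<bullet> x + snd \<phi>) / norm (x, 1::real)"
      by (simp add: homogenise_def inner_prod_def divide_inverse algebra_simps)
    moreover have "norm (x, 1::real) \<noteq> 0"
      by (simp add: zero_prod_def)
    ultimately show ?thesis
      by (simp add: eq_neg_iff_add_eq_0 del: norm_eq_zero)
  qed
  then show ?thesis by (auto simp: pierces_def)
qed

lemma compact_connected_homogenise:
  assumes "compact B" "connected B"
  shows "compact (homogenise ` B)" "connected (homogenise ` B)" "homogenise ` B \<subseteq> sphere 0 1"
proof -
  have "continuous_on B homogenise"
    unfolding homogenise_def by (intro continuous_intros) (auto simp: zero_prod_def)
  then show "compact (homogenise ` B)" "connected (homogenise ` B)"
    using assms by (auto intro: compact_continuous_image connected_continuous_image)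
  show "homogenise ` B \<subseteq> sphere 0 1"
    by (auto simp: norm_homogenise)
qed

lemma finite_hyperplane_transversal_of_pierced:
  fixes \<F> :: "(real ^ 'd) set set"
  assumes "finitely_pierced UNIV (\<lambda>B. homogenise ` B) \<F>"
  shows "has_finite_hyperplane_transversal \<F>"
proof -
  obtain \<Phi> where \<Phi>: "finite \<Phi>" "\<Phi> \<subseteq> UNIV - {0}"
    "\<forall>B\<in>\<F>. \<exists>\<phi>\<in>\<Phi>. pierces \<phi> (homogenise ` B)"
    using assms unfolding finitely_pierced_def by blast
  define H where "H \<phi> = {x :: real ^ 'd. fst \<phi> \<bullet> x = - snd \<phi>}" for \<phi> :: "(real ^ 'd) \<times> real"
  have "\<exists>K\<in>H ` {\<phi>\<in>\<Phi>. fst \<phi> \<noteq> 0}. B \<inter> K \<noteq> {}" if B: "B \<in> \<F>" for B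
  proof -
    obtain \<phi> where "\<phi> \<in> \<Phi>" "pierces \<phi> (homogenise ` B)"
      using \<Phi>(3) B by blast
    then obtain x where \<phi>: "\<phi> \<in> \<Phi>" "x \<in> B" "fst \<phi> \<bullet> x = - snd \<phi>"
      unfolding pierces_homogenise by blast
    moreover have "fst \<phi> \<noteq> 0"
      using \<phi> \<Phi>(2) by (auto simp: prod_eq_iff)
    moreover have "x \<in> B \<inter> H \<phi>"
      using \<phi> by (simp add: H_def)
    ultimately show ?thesis by blast
  qed
  moreover have "is_hyperplane (H \<phi>)" if "fst \<phi> \<noteq> 0" for \<phi>
    using that by (auto simp: is_hyperplane_iff H_def)
  ultimately show ?thesis
    unfolding has_finite_hyperplane_transversal_def using \<Phi>(1)
    by (intro exI[of _ "H ` {\<phi>\<in>\<Phi>. fst \<phi> \<noteq> 0}"]) auto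
qed

theorem theorem5:
  fixes \<F> :: "(real ^ 'd) set set"
  assumes "\<And>B. B \<in> \<F> \<Longrightarrow> compact B \<and> connected B"
    and "\<not> has_finite_hyperplane_transversal \<F>"
    and "\<exists>(p :: real ^ 'd) (v :: real ^ 'd). norm v = 1 \<and>
           (\<forall>n::nat. n \<ge> 1 \<longrightarrow>
              \<not> has_finite_hyperplane_transversal {B \<in> \<F>. B \<subseteq> ray_region p v n})"
  shows "\<exists>B :: nat \<Rightarrow> (real ^ 'd) set. range B \<subseteq> \<F> \<and>
           (\<forall>i :: nat \<Rightarrow> nat. inj_on i {1..CARD('d) + 1} \<longrightarrow>
              \<not> (\<exists>H. is_hyperplane H \<and> (\<forall>k\<in>{1..CARD('d) + 1}. H \<inter> B (i k) \<noteq> {})))"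
proof -
  have "\<exists>B. (\<forall>n::nat. B n \<in> \<F>) \<and> (\<forall>\<phi>\<in>UNIV - {0}. \<forall>I. card I = Suc CARD('d) \<longrightarrow>
      (\<exists>n\<in>I. \<not> pierces \<phi> (homogenise ` B n)))"
  \<comment> \<open>A constant chain is enough to start, as the concentration at a point takes place
    inside the induction. The extra coordinate raises the dimension to \<open>Suc CARD('d)\<close>,
    which is the number of indices wanted.\<close>
  proof (rule linear_hyperplane_sequence[where F = "\<lambda>_. \<F>"])
    show "dim (UNIV :: ((real ^ 'd) \<times> real) set) = Suc CARD('d)"
      by simp
    show "compact (homogenise ` B) \<and> connected (homogenise ` B) \<and>
        homogenise ` B \<subseteq> UNIV \<inter> sphere 0 1" if "B \<in> \<F>" for B
      using compact_connected_homogenise[of B] assms(1)[OF that] by simp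
    show "\<not> finitely_pierced UNIV (\<lambda>B. homogenise ` B) \<F>"
      using assms(2) finite_hyperplane_transversal_of_pierced by blast
  qed (auto simp: decseq_def)
  then obtain B where B: "\<And>n::nat. B n \<in> \<F>"
    "\<And>\<phi> I. \<phi> \<noteq> 0 \<Longrightarrow> card I = Suc CARD('d) \<Longrightarrow> \<exists>n\<in>I. \<not> pierces \<phi> (homogenise ` B n)"
    by (metis DiffI UNIV_I singletonD)
  have False if i: "inj_on i {1..CARD('d) + 1}" and H: "is_hyperplane H"
    and meets: "\<forall>k\<in>{1..CARD('d) + 1}. H \<inter> B (i k) \<noteq> {}" for i H
  proof -
    obtain a c where ac: "a \<noteq> 0" "H = {x. a \<bullet> x = c}"
      using H by (auto simp: is_hyperplane_iff)
    have "card (i ` {1..CARD('d) + 1}) = Suc CARD('d)"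
      using card_image[OF i] by simp
    \<comment> \<open>The sign comes from the equation
      \<open>fst \<phi> \<bullet> x = - snd \<phi>\<close> in
      \<open>pierces_homogenise\<close>.\<close>
    moreover have "(a, - c) \<noteq> 0"
      using ac(1) by (simp add: zero_prod_def)
    ultimately obtain k where "k \<in> {1..CARD('d) + 1}" "\<not> pierces (a, - c) (homogenise ` B (i k))"
      using B(2)[of "(a, - c)" "i ` {1..CARD('d) + 1}"] by blast
    then show False
      using meets ac(2) by (fastforce simp: pierces_homogenise)
  qed
  then show ?thesis
    using B(1) by (intro exI[of _ B]) blast
qed

end
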